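(* For $n=2$, the quasi-eigenfunction $F(\alpha)=F(\zeta_1,\zeta_2;\alpha,q,t)$ at $\alpha=q^{1/2}t^{1/2}$ is $$F(q^{1/2}t^{1/2})={\rm Pfaffian}\left(\frac{1-\zeta_j^2/\zeta_i^2}{(1-q^{-1/2}t^{1/2}\zeta_j/\zeta_i)(1-q^{1/2}t^{-1/2}\zeta_j/\zeta_i)}\right)_{1\le i,j\le2}\cdot\frac{(q^{1/2}t^{-1/2}\zeta_2/\zeta_1;q)_\infty}{(q^{1/2}t^{1/2}\zeta_2/\zeta_1;q)_\infty},$$ that is, $$F(q^{1/2}t^{1/2})=\frac{1-\zeta_2^2/\zeta_1^2}{(1-q^{-1/2}t^{1/2}\zeta_2/\zeta_1)(1-q^{1/2}t^{-1/2}\zeta_2/\zeta_1)}\cdot\frac{(q^{1/2}t^{-1/2}\zeta_2/\zeta_1;q)_\infty}{(q^{1/2}t^{1/2}\zeta_2/\zeta_1;q)_\infty}.$$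
   Context: $(a;q)_\infty=\prod_{k\ge0}(1-aq^k)$, $(a;q)_k=\prod_{i=0}^{k-1}(1-aq^i)$, with $0<|q|<1$, $t$ generic, and fixed square roots $q^{1/2},t^{1/2}$. For $n=2$ the quasi-eigenfunction is the formal power series in $\zeta_2/\zeta_1$ $$F(\zeta_1,\zeta_2;\alpha,q,t)=(1-\zeta_2/\zeta_1)\sum_{k\ge0}\frac{(qt^{-1};q)_k(\alpha qt^{-1};q)_k}{(q;q)_k(\alpha^{-1}q;q)_k}(\alpha^{-1}t\,\zeta_2/\zeta_1)^k .$$ Rational functions are expanded as power series in $\zeta_2/\zeta_1$. *)

theory Defs
  imports
    "HOL-Analysis.Analysis"
    "HOL-Computational_Algebra.Formal_Laurent_Series"
    "HOL-Combinatorics.Permutations"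
begin

text \<open>
  Every expression involved is homogeneous of degree 0 in the two variables \<open>\<zeta>\<^sub>1\<close>, \<open>\<zeta>\<^sub>2\<close>, i.e. a
  function of \<open>X = \<zeta>\<^sub>2 / \<zeta>\<^sub>1\<close>. Power series in \<open>\<zeta>\<^sub>2 / \<zeta>\<^sub>1\<close> are elements of \<^typ>\<open>complex fps\<close>. Rational
  functions are computed in the field \<^typ>\<open>complex fls\<close>, where division is expansion in powers
  of \<open>X\<close>; in particular \<open>\<zeta>\<^sub>1 / \<zeta>\<^sub>2\<close> is the inverse of \<open>X\<close>.
\<close>

definition qpoch :: "'a::comm_ring_1 \<Rightarrow> 'a \<Rightarrow> nat \<Rightarrow> 'a"
  where "qpoch a q k = (\<Prod>i<k. 1 - a * q ^ i)"

text \<open>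
  The power series \<open>(a X; q)\<^sub>\<infinity>\<close>. The partial products do not converge in the \<open>X\<close>-adic metric
  with which the library equips \<^typ>\<open>complex fps\<close>, so the infinite product is the coefficientwise
  limit in the complex numbers. The limit exists for \<open>|q| < 1\<close>, see
  \<open>convergent_qpoch_fps_nth\<close> below.
\<close>

definition qpoch_inf_fps :: "complex \<Rightarrow> complex \<Rightarrow> complex fps"
  where "qpoch_inf_fps a q =
    Abs_fps (\<lambda>n. lim (\<lambda>N. fps_nth (qpoch (fps_const a * fps_X) (fps_const q) N) n))"

lemma convergent_qpoch_fps_nth:
  fixes a q :: complex
  assumes "norm q < 1"
  shows "convergent (\<lambda>N. fps_nth (qpoch (fps_const a * fps_X) (fps_const q) N) n)"
proof (induction n)
  case 0
  have "fps_nth (qpoch (fps_const a * fps_X) (fps_const q) N) 0 = 1" for N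
    by (induction N) (simp_all add: qpoch_def fps_mult_nth_0)
  then show ?case by (simp add: convergent_const)
next
  case (Suc n)
  define c where "c m N = fps_nth (qpoch (fps_const a * fps_X) (fps_const q) N) m" for m N
  have step: "c (Suc n) (Suc N) - c (Suc n) N = - (a * q ^ N) * c n N" for N
  proof -
    have "qpoch (fps_const a * fps_X) (fps_const q) (Suc N)
        = qpoch (fps_const a * fps_X) (fps_const q) N
          - fps_const (a * q ^ N) * (fps_X * qpoch (fps_const a * fps_X) (fps_const q) N)"
      by (simp add: qpoch_def fps_const_power algebra_simps flip: fps_const_mult)
    then show ?thesis by (simp add: c_def)
  qed
  have "Bseq (c n)"
    using Suc convergent_imp_Bseq unfolding c_def by blast
  then obtain K where K: "\<And>N. norm (c n N) \<le> K"
    by (auto simp: Bseq_def)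
  have "summable (\<lambda>N. norm a * K * norm q ^ N)"
    using assms by (intro summable_mult summable_geometric) simp
  then have "summable (\<lambda>N. c (Suc n) (Suc N) - c (Suc n) N)"
  proof (rule summable_comparison_test')
    fix N :: nat
    have "norm a * norm q ^ N * norm (c n N) \<le> norm a * norm q ^ N * K"
      by (intro mult_left_mono K) simp
    then show "norm (c (Suc n) (Suc N) - c (Suc n) N) \<le> norm a * K * norm q ^ N"
      by (simp add: step norm_mult norm_power mult_ac)
  qed
  then have "convergent (\<lambda>N. \<Sum>k<N. c (Suc n) (Suc k) - c (Suc n) k)"
    by (simp add: summable_iff_convergent)
  then have "convergent (\<lambda>N. c (Suc n) N - c (Suc n) 0)"
    by (simp add: sum_lessThan_telescope)
  then have "convergent (\<lambda>N. c (Suc n) N - c (Suc n) 0 + c (Suc n) 0)"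
    by (intro convergent_add convergent_const)
  then show ?case by (simp add: c_def)
qed

text \<open>The quasi-eigenfunction \<open>F(\<zeta>\<^sub>1, \<zeta>\<^sub>2; \<alpha>, q, t)\<close> as a power series in \<open>X = \<zeta>\<^sub>2 / \<zeta>\<^sub>1\<close>.\<close>

definition quasi_eigenfunction :: "complex \<Rightarrow> complex \<Rightarrow> complex \<Rightarrow> complex fps"
  where "quasi_eigenfunction \<alpha> q t = (1 - fps_X) *
    Abs_fps (\<lambda>k. (qpoch (q / t) q k * qpoch (\<alpha> * q / t) q k)
                 / (qpoch q q k * qpoch (q / \<alpha>) q k) * (t / \<alpha>) ^ k)"

text \<open>The Pfaffian of a skew-symmetric matrix with rows and columns indexed by \<open>1, \<dots>, 2m\<close>.\<close>

definition pfaffian :: "nat \<Rightarrow> (nat \<Rightarrow> nat \<Rightarrow> 'a::field_char_0) \<Rightarrow> 'a"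
  where "pfaffian m A =
    (\<Sum>\<sigma> | \<sigma> permutes {1..2 * m}. of_int (sign \<sigma>) * (\<Prod>i=1..m. A (\<sigma> (2 * i - 1)) (\<sigma> (2 * i))))
    / (2 ^ m * fact m)"

end

theory Submission
  imports Defs
begin

text \<open>
  Put \<open>u = q\<^sup>1\<^sup>/\<^sup>2 t\<^sup>-\<^sup>1\<^sup>/\<^sup>2\<close>. At \<open>\<alpha> = q\<^sup>1\<^sup>/\<^sup>2 t\<^sup>1\<^sup>/\<^sup>2\<close> the \<open>k\<close>-th coefficient of the series is
  \<open>(u\<^sup>2;q)\<^sub>k / (q;q)\<^sub>k \<cdot> (1 - u q\<^sup>k) / (1 - u) \<cdot> u\<^sup>-\<^sup>k\<close>, so the series is \<open>(H(X) - u H(q X)) / (1 - u)\<close>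
  where \<open>H(X) = (u X; q)\<^sub>\<infinity> / (X/u; q)\<^sub>\<infinity>\<close> by the \<open>q\<close>-binomial theorem. The functional equation
  \<open>(1 - X/u) H(X) = (1 - u X) H(q X)\<close> then gives \<open>(1 + X) / (1 - u X) \<cdot> H(X)\<close>.
\<close>

section \<open>Finite q-Pochhammer symbols\<close>

lemma qpoch_0: "qpoch a q 0 = 1"
  by (simp add: qpoch_def)

lemma qpoch_Suc: "qpoch a q (Suc k) = qpoch a q k * (1 - a * q ^ k)"
  by (simp add: qpoch_def)

lemma qpoch_Suc_shift: "qpoch a q (Suc k) = (1 - a) * qpoch (a * q) q k"
  unfolding qpoch_def prod.lessThan_Suc_shift by (simp add: mult.assoc)

lemma power_neq_1_of_norm_less_1:
  fixes q :: complex
  assumes "norm q < 1" "n > 0"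
  shows "q ^ n \<noteq> 1"
  using assms by (metis norm_one norm_power power_less_one_iff norm_ge_zero less_irrefl)

lemma qpoch_self_neq_0:
  fixes q :: complex
  assumes "norm q < 1"
  shows "qpoch q q k \<noteq> 0"
  using power_neq_1_of_norm_less_1[OF assms, of "Suc _"] by (auto simp: qpoch_def)

section \<open>The infinite product as a power series\<close>

lemma qpoch_fps_scale:
  fixes a c q :: complex
  shows "qpoch (fps_const (a * c) * fps_X) (fps_const q) N
    = qpoch (fps_const a * fps_X) (fps_const q) N oo (fps_const c * fps_X)"
  by (simp add: qpoch_def fps_compose_prod_distrib fps_compose_sub_distrib
      fps_compose_mult_distrib mult_ac flip: fps_const_mult)

text \<open>Coefficientwise convergence for \<open>norm q < 1\<close> makes the \<open>lim\<close>
  in the definition a genuine limit. Facts about the infinite product are then transferred from its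
  partial products.\<close>

lemma tendsto_qpoch_fps_nth:
  assumes "norm q < 1"
  shows "(\<lambda>N. fps_nth (qpoch (fps_const a * fps_X) (fps_const q) N) n)
    \<longlonglongrightarrow> fps_nth (qpoch_inf_fps a q) n"
  using convergent_qpoch_fps_nth[OF assms] by (simp add: qpoch_inf_fps_def convergent_LIMSEQ_iff)

text \<open>Substituting c X for X multiplies the n-th coefficient by c^n, which commutes with the
  limit. For c = q this turns the shift from a to a q into the dilation of X by q.\<close>

lemma qpoch_inf_fps_scale:
  assumes "norm q < 1"
  shows "qpoch_inf_fps (a * c) q = qpoch_inf_fps a q oo (fps_const c * fps_X)"
proof (rule fps_ext)
  fix n
  have "(\<lambda>N. c ^ n * fps_nth (qpoch (fps_const a * fps_X) (fps_const q) N) n)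
      \<longlonglongrightarrow> c ^ n * fps_nth (qpoch_inf_fps a q) n"
    by (intro tendsto_intros tendsto_qpoch_fps_nth assms)
  with tendsto_qpoch_fps_nth[OF assms, of "a * c" n]
  show "fps_nth (qpoch_inf_fps (a * c) q) n
      = fps_nth (qpoch_inf_fps a q oo (fps_const c * fps_X)) n"
    by (simp add: qpoch_fps_scale LIMSEQ_unique del: fps_const_mult)
qed

lemma fps_nth_linear_mult:
  "fps_nth ((1 - fps_const a * fps_X) * f) n
    = fps_nth f n - a * (if n = 0 then 0 else fps_nth f (n - 1))"
  for a :: complex
  by (simp add: left_diff_distrib mult.assoc)

text \<open>The factor with index 0 is split off each partial product. A linear factor mixes only
  two neighbouring coefficients, so multiplying by it commutes with coefficientwise limits.\<close>

lemma qpoch_inf_fps_rec: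
  assumes "norm q < 1"
  shows "qpoch_inf_fps a q = (1 - fps_const a * fps_X) * qpoch_inf_fps (a * q) q"
proof (rule fps_ext)
  fix n
  have "qpoch (fps_const a * fps_X) (fps_const q) (Suc N)
      = (1 - fps_const a * fps_X) * qpoch (fps_const (a * q) * fps_X) (fps_const q) N" for N
    by (simp add: qpoch_Suc_shift mult_ac flip: fps_const_mult)
  moreover have "(\<lambda>N. fps_nth ((1 - fps_const a * fps_X) *
        qpoch (fps_const (a * q) * fps_X) (fps_const q) N) n)
      \<longlonglongrightarrow> fps_nth ((1 - fps_const a * fps_X) * qpoch_inf_fps (a * q) q) n"
    unfolding fps_nth_linear_mult
    by (cases "n = 0") (auto intro!: tendsto_intros tendsto_qpoch_fps_nth assms simp del: fps_const_mult)
  ultimately show "fps_nth (qpoch_inf_fps a q) n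
      = fps_nth ((1 - fps_const a * fps_X) * qpoch_inf_fps (a * q) q) n"
    \<comment> \<open>The index shift is needed because N + 1 factors on the left correspond to N
      factors after the split.\<close>
    using LIMSEQ_Suc[OF tendsto_qpoch_fps_nth[OF assms, of a n]]
    by (simp add: LIMSEQ_unique del: fps_const_mult)
qed

lemma qpoch_inf_fps_nth_0:
  assumes "norm q < 1"
  shows "fps_nth (qpoch_inf_fps a q) 0 = 1"
proof -
  have "fps_nth (qpoch (fps_const a * fps_X) (fps_const q) N) 0 = 1" for N
    by (induction N) (simp_all add: qpoch_0 qpoch_Suc)
  then show ?thesis
    using tendsto_qpoch_fps_nth[OF assms, of a 0] by (simp add: LIMSEQ_const_iff)
qed

section \<open>The q-binomial theorem via q-difference equations\<close>

text \<open>Comparing coefficients gives a first-order recursion whose leading factor 1 - q^(n+1) is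
  nonzero for \<open>norm q < 1\<close>, so the constant coefficient determines the whole
  series.\<close>

lemma q_difference_equation_unique:
  fixes f g :: "complex fps"
  assumes "norm q < 1"
    and f: "f = (1 - fps_const a * fps_X) * (f oo (fps_const q * fps_X))"
    and g: "g = (1 - fps_const a * fps_X) * (g oo (fps_const q * fps_X))"
    and "fps_nth f 0 = fps_nth g 0"
  shows "f = g"
proof (rule fps_ext)
  fix n
  show "fps_nth f n = fps_nth g n"
  proof (induction n)
    case (Suc n)
    have rec: "(1 - q ^ Suc n) * fps_nth h (Suc n) = - a * q ^ n * fps_nth h n"
      if "h = (1 - fps_const a * fps_X) * (h oo (fps_const q * fps_X))" for h
    proof -
      have "fps_nth h (Suc n) = q ^ Suc n * fps_nth h (Suc n) - a * (q ^ n * fps_nth h n)"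
        by (subst that) (simp add: fps_nth_linear_mult)
      then show ?thesis by (simp add: algebra_simps)
    qed
    have "(1 - q ^ Suc n) * fps_nth f (Suc n) = (1 - q ^ Suc n) * fps_nth g (Suc n)"
      using rec[OF f] rec[OF g] Suc by simp
    then show ?case
      using power_neq_1_of_norm_less_1[OF assms(1), of "Suc n"] by simp
  qed (rule assms)
qed

text \<open>The basic hypergeometric series 1phi0(a; -; q, z X), that is, the series side of the
  q-binomial theorem.\<close>

definition qbinom_fps :: "complex \<Rightarrow> complex \<Rightarrow> complex \<Rightarrow> complex fps"
  where "qbinom_fps a z q = Abs_fps (\<lambda>k. qpoch a q k / qpoch q q k * z ^ k)"

text \<open>At X^(k+1) this is the ratio recursion of consecutive coefficients, (1 - q^(k+1)) r(k+1)
  = (1 - a q^k) r(k), multiplied by z^(k+1).\<close>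

lemma qbinom_fps_functional_equation:
  assumes "norm q < 1"
  shows "(1 - fps_const z * fps_X) * qbinom_fps a z q
    = (1 - fps_const (a * z) * fps_X) * (qbinom_fps a z q oo (fps_const q * fps_X))"
proof (rule fps_ext)
  fix n
  show "fps_nth ((1 - fps_const z * fps_X) * qbinom_fps a z q) n
    = fps_nth ((1 - fps_const (a * z) * fps_X) * (qbinom_fps a z q oo (fps_const q * fps_X))) n"
  proof (cases n)
    case 0
    then show ?thesis by (simp add: fps_nth_linear_mult del: fps_const_mult)
  next
    case (Suc k)
    define r where "r k = qpoch a q k / qpoch q q k" for k
    have "r (Suc k) * (1 - q ^ Suc k) = r k * (1 - a * q ^ k)"
      using qpoch_self_neq_0[OF assms, of k] qpoch_self_neq_0[OF assms, of "Suc k"]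
      by (simp add: r_def qpoch_Suc)
    then have "r (Suc k) * (1 - q ^ Suc k) * z ^ Suc k = r k * (1 - a * q ^ k) * z ^ Suc k"
      by simp
    moreover have "fps_nth (qbinom_fps a z q) m = r m * z ^ m" for m
      by (simp add: qbinom_fps_def r_def)
    ultimately show ?thesis
      unfolding Suc fps_nth_linear_mult fps_nth_compose_linear by (simp add: algebra_simps)
  qed
qed

text \<open>Both sides solve the same q-difference equation and have constant coefficient 1.
  Clearing the denominator (z X; q)_inf avoids inverting a power series.\<close>

lemma q_binomial_theorem:
  assumes "norm q < 1"
  shows "qbinom_fps a z q * qpoch_inf_fps z q = qpoch_inf_fps (a * z) q"
proof (rule q_difference_equation_unique[OF assms])
  let ?S = "\<lambda>f. f oo (fps_const q * fps_X)"
  have rec: "qpoch_inf_fps b q = (1 - fps_const b * fps_X) * ?S (qpoch_inf_fps b q)" for b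
    using qpoch_inf_fps_rec[OF assms] by (simp add: qpoch_inf_fps_scale[OF assms])
  then show "qpoch_inf_fps (a * z) q
      = (1 - fps_const (a * z) * fps_X) * ?S (qpoch_inf_fps (a * z) q)" .
  \<comment> \<open>The factor 1 - z X released by the infinite product is what the functional
    equation of the series trades for 1 - a z X and a dilation.\<close>
  have "qbinom_fps a z q * qpoch_inf_fps z q
      = ((1 - fps_const z * fps_X) * qbinom_fps a z q) * ?S (qpoch_inf_fps z q)"
    by (subst rec) (simp add: mult_ac)
  also have "\<dots> = (1 - fps_const (a * z) * fps_X) * ?S (qbinom_fps a z q * qpoch_inf_fps z q)"
    unfolding qbinom_fps_functional_equation[OF assms]
    by (simp add: fps_compose_mult_distrib mult.assoc)
  finally show "qbinom_fps a z q * qpoch_inf_fps z q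
      = (1 - fps_const (a * z) * fps_X) * ?S (qbinom_fps a z q * qpoch_inf_fps z q)" .
  show "fps_nth (qbinom_fps a z q * qpoch_inf_fps z q) 0 = fps_nth (qpoch_inf_fps (a * z) q) 0"
    by (simp add: qpoch_inf_fps_nth_0[OF assms] qbinom_fps_def qpoch_0)
qed

section \<open>The quasi-eigenfunction in product form\<close>

text \<open>Both cross products equal (u;q)_(k+1), with either its last or its first factor split
  off. The quotient is thus affine in q^k, which is what allows the series to be written with H(X)
  and H(q X) alone.\<close>

lemma qpoch_shift_quotient:
  fixes u q :: complex
  assumes "\<forall>k. qpoch u q k \<noteq> 0"
  shows "qpoch (u * q) q k / qpoch u q k = (1 - u * q ^ k) / (1 - u)"
proof -
  \<comment> \<open>This is the genericity hypothesis at k = 1.\<close>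
  have "1 - u \<noteq> 0"
    using assms[rule_format, of 1] by (simp add: qpoch_def)
  moreover have "qpoch u q k * (1 - u * q ^ k) = (1 - u) * qpoch (u * q) q k"
    by (metis qpoch_Suc qpoch_Suc_shift)
  ultimately show ?thesis
    using assms by (simp add: frac_eq_eq mult_ac)
qed

text \<open>All denominators in X are cleared, so the computation stays in the ring of power series;
  division is postponed to the Laurent field.\<close>

lemma quasi_eigenfunction_product:
  fixes q t q_half t_half :: complex
  assumes q: "0 < norm q" "norm q < 1" and t: "t \<noteq> 0"
    and half: "q_half ^ 2 = q" "t_half ^ 2 = t"
    and generic: "\<forall>k. qpoch (q / (q_half * t_half)) q k \<noteq> 0"
  shows "quasi_eigenfunction (q_half * t_half) q t *
      ((1 - fps_const (t_half / q_half) * fps_X) * (1 - fps_const (q_half / t_half) * fps_X) *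
        qpoch_inf_fps (q_half * t_half) q)
    = (1 - fps_X ^ 2) * qpoch_inf_fps (q_half / t_half) q"
proof -
  define u where "u = q_half / t_half"
  define H where "H = qbinom_fps (u ^ 2) (1 / u) q"
  define HS where "HS = H oo (fps_const q * fps_X)"
  have nz: "q_half \<noteq> 0" "t_half \<noteq> 0" "u \<noteq> 0"
    using q t half by (auto simp: u_def)
  \<comment> \<open>Since q / \<alpha> = u, genericity says that no (u;q)_k vanishes. The form
    \<open>1 / u * q\<close> in the last equation matches the shifted argument in
    \<open>qpoch_inf_fps_rec\<close>.\<close>
  have eqs: "q / (q_half * t_half) = u" "q / t = u ^ 2" "q_half * t_half * q / t = u * q"
    "t / (q_half * t_half) = 1 / u" "t_half / q_half = 1 / u" "q_half * t_half = 1 / u * q"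
    using nz unfolding u_def half[symmetric] by (auto simp: field_simps power2_eq_square)
  have u: "\<forall>k. qpoch u q k \<noteq> 0"
    using generic unfolding eqs(1) .
  then have u1: "1 - u \<noteq> 0"
    by (metis qpoch_0 qpoch_Suc mult_1 mult.right_neutral power_0)
  have series: "fps_const (1 - u) * quasi_eigenfunction (q_half * t_half) q t
      = (1 - fps_X) * (H - fps_const u * HS)"
  proof -
    have "qpoch (u ^ 2) q k * qpoch (u * q) q k / (qpoch q q k * qpoch u q k) * (1 / u) ^ k
        = (fps_nth H k - u * fps_nth HS k) / (1 - u)" for k
    proof -
      have "qpoch (u ^ 2) q k * qpoch (u * q) q k / (qpoch q q k * qpoch u q k) * (1 / u) ^ k
          = qpoch (u ^ 2) q k / qpoch q q k * (qpoch (u * q) q k / qpoch u q k) * (1 / u) ^ k"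
        by simp
      also have "\<dots> = qpoch (u ^ 2) q k / qpoch q q k * (1 / u) ^ k * ((1 - u * q ^ k) / (1 - u))"
        unfolding qpoch_shift_quotient[OF u] by simp
      also have "\<dots> = fps_nth H k * ((1 - u * q ^ k) / (1 - u))"
        by (simp add: H_def qbinom_fps_def)
      \<comment> \<open>Dilation by q contributes the factor q^k, so 1 - u q^k becomes the
        combination H - u HS.\<close>
      also have "\<dots> = (fps_nth H k - u * fps_nth HS k) / (1 - u)"
        unfolding HS_def fps_nth_compose_linear by (simp add: algebra_simps)
      finally show ?thesis .
    qed
    then have "fps_const (1 - u) * Abs_fps (\<lambda>k. qpoch (u ^ 2) q k * qpoch (u * q) q k
          / (qpoch q q k * qpoch u q k) * (1 / u) ^ k) = H - fps_const u * HS"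
      using u1 by (intro fps_ext) simp
    then show ?thesis
      unfolding quasi_eigenfunction_def eqs(1-4)
      by (simp only: mult.left_commute[of "fps_const (1 - u)"])
  qed
  have fe: "(1 - fps_const (1 / u) * fps_X) * H = (1 - fps_const u * fps_X) * HS"
    using qbinom_fps_functional_equation[OF q(2), of "1 / u" "u ^ 2"] nz
    by (simp add: H_def HS_def power2_eq_square)
  \<comment> \<open>This is the q-binomial theorem at a = u^2, z = 1/u, where a z = u. Splitting 1 -
    X/u off (X/u; q)_inf leaves (q X/u; q)_inf, the denominator product of the claim.\<close>
  have binom: "H * ((1 - fps_const (1 / u) * fps_X) * qpoch_inf_fps (1 / u * q) q) = qpoch_inf_fps u q"
    using q_binomial_theorem[OF q(2), of "u ^ 2" "1 / u"] qpoch_inf_fps_rec[OF q(2), of "1 / u"] nz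
    by (simp add: H_def power2_eq_square)
  have uu: "fps_const u * fps_const (1 / u) = 1"
    using nz by simp
  \<comment> \<open>By \<open>fe\<close>, HS is eliminated in favour of H; what remains is 1 - u X -
    u + X = (1 - u)(1 + X).\<close>
  have "(1 - fps_const u * fps_X) * (H - fps_const u * HS)
      = (1 - fps_const u * fps_X) * H - fps_const u * ((1 - fps_const (1 / u) * fps_X) * H)"
    unfolding fe by (simp only: algebra_simps mult_1_left mult_1_right)
  also have "\<dots> = (1 - fps_const u * fps_X - fps_const u
      + (fps_const u * fps_const (1 / u)) * fps_X) * H"
    by (simp only: algebra_simps mult_1_left mult_1_right)
  also have "\<dots> = fps_const (1 - u) * (1 + fps_X) * H"
    unfolding uu by (simp add: algebra_simps flip: fps_const_sub)
  finally have bracket: "(1 - fps_const u * fps_X) * (H - fps_const u * HS)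
      = fps_const (1 - u) * (1 + fps_X) * H" .
  let ?F = "quasi_eigenfunction (q_half * t_half) q t"
  let ?R = "(1 - fps_const (1 / u) * fps_X) * qpoch_inf_fps (1 / u * q) q"
  \<comment> \<open>The scalar 1 - u is carried on both sides and cancelled at the end. The
    prefactor 1 - X of F meets 1 + X from \<open>bracket\<close> to give 1 - X^2.\<close>
  have "fps_const (1 - u) * (?F * ((1 - fps_const u * fps_X) * ?R))
      = (1 - fps_X) * ((1 - fps_const u * fps_X) * (H - fps_const u * HS)) * ?R"
    unfolding mult.assoc[symmetric] series by (simp only: mult_ac)
  also have "\<dots> = fps_const (1 - u) * ((1 - fps_X) * (1 + fps_X) * (H * ?R))"
    unfolding bracket by (simp only: mult_ac)
  also have "(1 - fps_X) * (1 + fps_X) = 1 - (fps_X :: complex fps) ^ 2"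
    by (simp add: algebra_simps power2_eq_square)
  finally have "?F * ((1 - fps_const u * fps_X) * ?R) = (1 - fps_X ^ 2) * qpoch_inf_fps u q"
    using u1 unfolding binom by (simp del: fps_const_sub)
  then show ?thesis
    unfolding eqs(5) u_def[symmetric] eqs(6)[symmetric] by (simp only: mult_ac)
qed

section \<open>The 2 by 2 Pfaffian and the identity of Laurent series\<close>

text \<open>The transposition has sign -1 and by skew-symmetry contributes the same as the identity,
  so the sum is 2 A(1,2) and the normalisation 2^1 1! removes the 2.\<close>

lemma pfaffian_1:
  fixes A :: "nat \<Rightarrow> nat \<Rightarrow> 'a::field_char_0"
  assumes "A 2 1 = - A 1 2"
  shows "pfaffian 1 A = A 1 2"
proof -
  have set: "{1..2 * 1} = {1, 2 :: nat}" by auto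
  have "{\<sigma>. \<sigma> permutes {1..2 * 1 :: nat}} = {id, Transposition.transpose 1 2}"
    unfolding set permutes_doubleton_iff by auto
  moreover have "id \<noteq> Transposition.transpose 1 (2::nat)"
    by (metis id_apply transpose_apply_first n_not_Suc_n numeral_2_eq_2 One_nat_def)
  ultimately show ?thesis
    using assms by (simp add: pfaffian_def sign_swap_id)
qed

theorem proposition7p5:
  fixes q t q_half t_half \<alpha> :: complex and \<zeta> :: "nat \<Rightarrow> complex fls"
  assumes "0 < norm q" and "norm q < 1" and "t \<noteq> 0"
    and "q_half ^ 2 = q" and "t_half ^ 2 = t"
    and "\<alpha> = q_half * t_half"
    and generic: "\<forall>k. qpoch (q / \<alpha>) q k \<noteq> 0"
    and "\<zeta> 1 \<noteq> 0" and "\<zeta> 2 / \<zeta> 1 = fls_X"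
  shows "fps_to_fls (quasi_eigenfunction \<alpha> q t) =
      pfaffian 1 (\<lambda>i j. (1 - (\<zeta> j)^2 / (\<zeta> i)^2) /
        ((1 - fls_const (t_half / q_half) * (\<zeta> j / \<zeta> i)) *
         (1 - fls_const (q_half / t_half) * (\<zeta> j / \<zeta> i)))) *
      (fps_to_fls (qpoch_inf_fps (q_half / t_half) q) /
       fps_to_fls (qpoch_inf_fps (q_half * t_half) q))
    \<and> fps_to_fls (quasi_eigenfunction \<alpha> q t) =
      (1 - (\<zeta> 2)^2 / (\<zeta> 1)^2) /
        ((1 - fls_const (t_half / q_half) * (\<zeta> 2 / \<zeta> 1)) *
         (1 - fls_const (q_half / t_half) * (\<zeta> 2 / \<zeta> 1))) *
      (fps_to_fls (qpoch_inf_fps (q_half / t_half) q) /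
       fps_to_fls (qpoch_inf_fps (q_half * t_half) q))"
proof -
  define u where "u = q_half / t_half"
  define X :: "complex fls" where "X = fls_X"
  define D where "D = (1 - fls_const (1 / u) * X) * (1 - fls_const u * X)"
  define P where "P = fps_to_fls (qpoch_inf_fps u q)"
  define Q where "Q = fps_to_fls (qpoch_inf_fps (q_half * t_half) q)"
  define E where "E = (1 - fps_const (1 / u) * fps_X) * (1 - fps_const u * fps_X)"
  have u: "u \<noteq> 0" "t_half / q_half = 1 / u"
    using assms(1,3-5) by (auto simp: u_def)
  have E: "fps_to_fls E = D"
    by (simp add: E_def D_def X_def fls_times_fps_to_fls)
  \<comment> \<open>Constant coefficient 1 makes the series nonzero, hence its image
    \<open>D\<close> invertible in the Laurent field; the same argument serves for
    \<open>Q\<close>.\<close>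
  have "fps_nth E 0 = 1"
    by (simp add: E_def)
  then have D0: "D \<noteq> 0"
    unfolding E[symmetric] by auto
  have "fps_nth (qpoch_inf_fps (q_half * t_half) q) 0 = 1"
    by (rule qpoch_inf_fps_nth_0) fact
  then have Q0: "Q \<noteq> 0"
    unfolding Q_def by auto
  have "quasi_eigenfunction \<alpha> q t * (E * qpoch_inf_fps (q_half * t_half) q)
      = (1 - fps_X ^ 2) * qpoch_inf_fps u q"
    using quasi_eigenfunction_product[OF assms(1-5) generic[unfolded \<open>\<alpha> = _\<close>]]
    unfolding \<open>\<alpha> = _\<close> u(2) E_def u_def[symmetric] .
  from arg_cong[OF this, of fps_to_fls]
  have "fps_to_fls (quasi_eigenfunction \<alpha> q t) * (D * Q) = (1 - X ^ 2) * P"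
    by (simp add: E P_def Q_def X_def fls_times_fps_to_fls fps_to_fls_power)
  then have F: "fps_to_fls (quasi_eigenfunction \<alpha> q t) = (1 - X ^ 2) / D * (P / Q)"
    using D0 Q0 by (simp add: field_simps)
  let ?A = "\<lambda>i j. (1 - (\<zeta> j)^2 / (\<zeta> i)^2) /
        ((1 - fls_const (1 / u) * (\<zeta> j / \<zeta> i)) * (1 - fls_const u * (\<zeta> j / \<zeta> i)))"
  have X0: "X \<noteq> 0"
    by (simp add: X_def)
  have X: "\<zeta> 2 / \<zeta> 1 = X" "\<zeta> 1 / \<zeta> 2 = 1 / X"
    using assms(8,9) by (auto simp: X_def field_simps)
  have A12: "?A 1 2 = (1 - X ^ 2) / D"
    by (simp only: power_divide[symmetric] X D_def)
  \<comment> \<open>As the two constants are reciprocal, \<open>D\<close> is a palindromic quadratic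
    in X, so replacing X by 1/X yields D / X^2. The numerator 1 - X^2 becomes -(1 - X^2) / X^2, and
    the entry changes sign: this is the skew-symmetry that the Pfaffian requires.\<close>
  have "fls_const (1 / u) * fls_const u = 1"
    using u by simp
  then have "(1 - fls_const (1 / u) * (1 / X)) * (1 - fls_const u * (1 / X)) = D / X ^ 2"
    using X0 by (simp add: D_def field_simps power2_eq_square)
  then have "?A 2 1 = (1 - (1 / X) ^ 2) / (D / X ^ 2)"
    by (simp only: power_divide[symmetric] X)
  also have "\<dots> = - ((1 - X ^ 2) / D)"
    using X0 D0 by (simp add: field_simps)
  finally have "pfaffian 1 ?A = ?A 1 2"
    using A12 by (intro pfaffian_1) simp
  then show ?thesis
    unfolding u(2) u_def[symmetric] using F A12 by (simp add: P_def Q_def)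
qed

end
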